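(* Let $G(S,A,U)$ be a weighted directed graph with $n$ vertices (vertex set $S$, arc set $A$, weights $U_{ij}$ on arcs $(i\rightarrow j)\in A$) such that for every $1\le k\le n$ the optimal W-graph with $k$ sinks, $g^{\ast}_k$, is unique. Then for all $1\le k<n$ the following hold. \begin{enumerate} \item Every sink of $g^{\ast}_k$ is also a sink of $g^{\ast}_{k+1}$. \item Let $S_k$ be the set of vertices in the connected component of $g^{\ast}_{k+1}$ containing no sink of $g^{\ast}_{k}$. The collection of arcs of $g^{\ast}_{k+1}$ with tail in $S\setminus S_k$ coincides with the collection of arcs of $g^{\ast}_k$ with tail in $S\setminus S_k$. \item There is exactly one arc in $g^{\ast}_k$ with tail in $S_k$ and head in $S\setminus S_k$. \end{enumerate}
   Context: $G(S,A,U)$ denotes a finite directed graph with vertex set $S$, $|S|=n$, arc set $A$ consisting of ordered pairs $(i\rightarrow j)$ with $i\neq j$ ($i$ is the tail and $j$ is the head), and a real weight $U_{ij}$ assigned to each arc $(i\rightarrow j)\in A$. A W-graph with $k$ sinks for $G(S,A,U)$ is a subgraph of $G$ with vertex set $S$ obtained as follows: select a set of $k$ vertices, called sinks; choose a subset of $n-k$ arcs of $A$ so that there is exactly one outgoing arc from every non-sink vertex (and none from the sinks), and the resulting graph has no (directed) cycles. In particular, the W-graph with $n$ sinks has no arcs. Let $G_k$ denote the set of all W-graphs with $k$ sinks. An optimal W-graph with $k$ sinks is a minimizer $$g^{\ast}_k = \arg\min_{g\in G_k}\sum_{(i\rightarrow j)\in g}U_{ij},\qquad 1\le k\le n.$$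 Uniqueness of $g^{\ast}_k$ means that $G_k$ is nonempty and this minimum is attained at exactly one W-graph. Connected components of a W-graph are those of the undirected graph obtained by erasing arc directions; each connected component of a W-graph contains exactly one sink, so a W-graph with $k$ sinks has $k$ connected components. Consequently, once item 1 holds, exactly one connected component of $g^{\ast}_{k+1}$ contains no sink of $g^{\ast}_k$, so that $S_k$ in items 2 and 3 is well defined. *)

theory Defs
  imports "Graph_Theory.Graph_Theory"
begin

definition sinks :: "'a pair_pre_digraph \<Rightarrow> 'a set" where
  "sinks H = {v \<in> pverts H. out_degree (with_proj H) v = 0}"

text \<open>
  The arc count is implied by the out-degree conditions; it is kept because the usual definition
  of a W-graph mentions it. The selected set \<open>T\<close> is then exactly \<open>sinks H\<close>.
\<close>
definition is_wgraph :: "'a pair_pre_digraph \<Rightarrow> nat \<Rightarrow> 'a pair_pre_digraph \<Rightarrow> bool" where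
  "is_wgraph G k H \<longleftrightarrow>
     spanning (with_proj H) (with_proj G) \<and>
     (\<exists>T \<subseteq> pverts G. card T = k \<and>
        card (parcs H) = card (pverts G) - k \<and>
        (\<forall>v \<in> T. out_degree (with_proj H) v = 0) \<and>
        (\<forall>v \<in> pverts G - T. out_degree (with_proj H) v = 1)) \<and>
     (\<nexists>p. pre_digraph.cycle (with_proj H) p)"

definition total_weight :: "('a \<times> 'a) weight_fun \<Rightarrow> 'a pair_pre_digraph \<Rightarrow> real" where
  "total_weight U H = (\<Sum>a\<in>parcs H. U a)"

abbreviation is_optimal_wgraph ::
    "'a pair_pre_digraph \<Rightarrow> ('a \<times> 'a) weight_fun \<Rightarrow> nat \<Rightarrow> 'a pair_pre_digraph \<Rightarrow> bool" where
  "is_optimal_wgraph G U k \<equiv> is_arg_min (total_weight U) (is_wgraph G k)"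

definition optimal_wgraph ::
    "'a pair_pre_digraph \<Rightarrow> ('a \<times> 'a) weight_fun \<Rightarrow> nat \<Rightarrow> 'a pair_pre_digraph" where
  "optimal_wgraph G U k = arg_min (total_weight U) (is_wgraph G k)"

text \<open>
  Connected components, as vertex sets, of the underlying undirected graph. In a symmetric
  digraph the strongly connected components are the connected components.
\<close>
definition conn_components :: "'a pair_pre_digraph \<Rightarrow> 'a set set" where
  "conn_components H = pre_digraph.sccs_verts (with_proj (mk_symmetric (with_proj H)))"

definition is_sinkless_component ::
    "'a pair_pre_digraph \<Rightarrow> ('a \<times> 'a) weight_fun \<Rightarrow> nat \<Rightarrow> 'a set \<Rightarrow> bool" where
  "is_sinkless_component G U k C \<longleftrightarrow>
     C \<in> conn_components (optimal_wgraph G U (k + 1)) \<and> C \<inter> sinks (optimal_wgraph G U k) = {}"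

definition absorbed_component ::
    "'a pair_pre_digraph \<Rightarrow> ('a \<times> 'a) weight_fun \<Rightarrow> nat \<Rightarrow> 'a set" where
  "absorbed_component G U k = (THE C. is_sinkless_component G U k C)"

end

theory Submission
  imports Defs
begin

text \<open>
  Let \<open>F\<close> and \<open>F'\<close> be the optimal W-graphs with \<open>k\<close> and \<open>k + 1\<close> sinks. By pigeonhole, some
  component \<open>C\<close> of \<open>F'\<close> contains no sink of \<open>F\<close>. Exchanging the arcs of \<open>F\<close> and \<open>F'\<close> with tail in \<open>C\<close>
  gives again one W-graph with \<open>k\<close> and one with \<open>k + 1\<close> sinks, of the same total weight, so by
  uniqueness the exchange changes nothing: \<open>F\<close> and \<open>F'\<close> agree off \<open>C\<close>. If \<open>F\<close> had two arcs leaving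
  \<open>C\<close>, one of them would be the exit of a set \<open>D\<close> of vertices that avoids the sink of \<open>F'\<close> in \<open>C\<close>.
  Exchanging the arcs with tail in \<open>D\<close> then gives W-graphs with \<open>k + 1\<close> and \<open>k\<close> sinks, and uniqueness
  forces \<open>F\<close> and \<open>F'\<close> to agree on \<open>D\<close>, although no arc of \<open>F'\<close> leaves \<open>C\<close>.
\<close>

section \<open>Acyclic functional relations\<close>

lemma card_single_valued: "single_valued R \<Longrightarrow> card R = card (Domain R)"
  unfolding Domain_fst by (subst card_image) (auto simp: single_valued_def inj_on_def)

text \<open>The converse of \<open>R\<close> is well-founded, so \<open>X\<close> has a minimal
  element for it; all successors of that element lie outside \<open>X\<close>.\<close>

lemma finite_acyclic_exit:
  assumes "finite R" "acyclic R" "X \<noteq> {}" "X \<subseteq> Domain R"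
  obtains u v where "(u, v) \<in> R" "u \<in> X" "v \<notin> X"
proof -
  have "wf (R\<inverse>)" using assms by (intro finite_acyclic_wf_converse)
  then obtain u where "u \<in> X" and min: "\<And>y. (y, u) \<in> R\<inverse> \<Longrightarrow> y \<notin> X"
    using \<open>X \<noteq> {}\<close> by (meson all_not_in_conv wfE_min)
  moreover obtain v where "(u, v) \<in> R" using assms \<open>u \<in> X\<close> by blast
  ultimately show thesis using that by blast
qed

text \<open>Induction along the undirected path. A backward step prepends an arc to the path to
  \<open>s\<close>. A forward step from \<open>v\<close> follows the only arc out of
  \<open>v\<close>, which is the first arc of the path from \<open>v\<close> to
  \<open>s\<close>.\<close>

lemma single_valued_symcl_sink:
  assumes "single_valued R" "(u, v) \<in> (R \<union> R\<inverse>)\<^sup>*" "(u, s) \<in> R\<^sup>*" "s \<notin> Domain R"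
  shows "(v, s) \<in> R\<^sup>*"
  using assms(2)
proof induction
  case (step v w)
  show ?case
  proof (cases "(w, v) \<in> R")
    case False
    then have vw: "(v, w) \<in> R" using step by blast
    then have "v \<noteq> s" using assms(4) by blast
    with step.IH obtain w' where "(v, w') \<in> R" "(w', s) \<in> R\<^sup>*" by (meson converse_rtranclE)
    then show ?thesis using vw assms(1) by (metis single_valuedD)
  qed (use step in auto)
qed (rule assms(3))

text \<open>Choosing by tail gives each vertex all its outgoing arcs from one source, so out-degrees
  and sinks can be read off vertex by vertex.\<close>

definition splice :: "'a set \<Rightarrow> 'a rel \<Rightarrow> 'a rel \<Rightarrow> 'a rel" where
  "splice X A B = {a \<in> A. fst a \<in> X} \<union> {a \<in> B. fst a \<notin> X}"

lemma mem_splice: "(u, v) \<in> splice X A B \<longleftrightarrow> (if u \<in> X then (u, v) \<in> A else (u, v) \<in> B)"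
  by (simp add: splice_def)

lemma splice_Compl: "splice (- X) A B = splice X B A"
  by (auto simp: splice_def)

lemma single_valued_splice:
  "single_valued A \<Longrightarrow> single_valued B \<Longrightarrow> single_valued (splice X A B)"
  by (auto simp: single_valued_def mem_splice split: if_splits)

lemma Domain_splice: "Domain (splice X A B) = (Domain A \<inter> X) \<union> (Domain B - X)"
  by (auto simp: mem_splice Domain_iff split: if_splits)

text \<open>Makes the exchange weight-neutral: the two opposite splices redistribute the arcs of
  \<open>A\<close> and \<open>B\<close>, counted with multiplicity.\<close>

lemma sum_splice:
  fixes w :: "'a \<times> 'a \<Rightarrow> 'b::comm_monoid_add"
  assumes "finite A" "finite B"
  shows "sum w (splice X A B) + sum w (splice X B A) = sum w A + sum w B"
proof -
  have part: "sum w {a \<in> R. fst a \<in> X} + sum w {a \<in> R. fst a \<notin> X} = sum w R" if "finite R" for R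
    using that by (subst sum.union_disjoint[symmetric]) (auto intro: arg_cong[where f = "sum w"])
  have splice: "sum w (splice X R Q) = sum w {a \<in> R. fst a \<in> X} + sum w {a \<in> Q. fst a \<notin> X}"
    if "finite R" "finite Q" for R Q
    unfolding splice_def using that by (intro sum.union_disjoint) auto
  then show ?thesis
    unfolding part[OF assms(1), symmetric] part[OF assms(2), symmetric]
      splice[OF assms] splice[OF assms(2,1)] by (simp add: ac_simps)
qed

text \<open>A path that has left \<open>X\<close> cannot return, so a cycle would lie inside
  \<open>X\<close> and belong to \<open>A\<close>, or outside \<open>X\<close> and belong to
  \<open>B\<close>.\<close>

lemma acyclic_splice:
  assumes "acyclic A" "acyclic B" and closed: "\<And>u v. (u, v) \<in> B \<Longrightarrow> u \<notin> X \<Longrightarrow> v \<notin> X"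
  shows "acyclic (splice X A B)"
proof -
  have "(u \<notin> X \<longrightarrow> v \<notin> X \<and> (u, v) \<in> B\<^sup>+) \<and> (u \<in> X \<and> v \<in> X \<longrightarrow> (u, v) \<in> A\<^sup>+)"
    if "(u, v) \<in> (splice X A B)\<^sup>+" for u v
    using that
  proof induction
    case (base v)
    then show ?case using closed by (auto simp: mem_splice split: if_splits)
  next
    case (step v w)
    then show ?case using closed
      by (auto simp: mem_splice split: if_splits intro: trancl_into_trancl)
  qed
  then show ?thesis using assms(1,2) unfolding acyclic_def by blast
qed

section \<open>W-graphs as arc sets\<close>

text \<open>With out-degrees at most one, the arc count fixes the number of sinks. Writing it as a
  sum rather than a truncated difference also forces \<open>k\<close> \<le>
  \<open>card (pverts G)\<close>.\<close>

definition wforest :: "'a pair_pre_digraph \<Rightarrow> nat \<Rightarrow> 'a rel \<Rightarrow> bool" where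
  "wforest G k F \<longleftrightarrow> F \<subseteq> parcs G \<and> single_valued F \<and> acyclic F \<and> card F + k = card (pverts G)"

lemma acyclic_iff_no_cycle:
  assumes "pair_wf_digraph H"
  shows "(\<nexists>p. pre_digraph.cycle (with_proj H) p) \<longleftrightarrow> acyclic (parcs H)"
proof -
  interpret pair_wf_digraph H by fact
  show ?thesis
  proof
    assume none: "\<nexists>p. cycle p"
    show "acyclic (parcs H)"
      unfolding acyclic_def
    proof safe
      fix x assume "(x, x) \<in> (parcs H)\<^sup>+"
      then have "\<exists>p. awalk x p x \<and> p \<noteq> []" using reachable1_awalk[of x x] by simp
      then have "\<exists>p. closed_w p" unfolding closed_w_def by auto
      then show False using none closed_w_imp_cycle by blast
    qed
  next
    assume "acyclic (parcs H)"
    then show "\<nexists>p. cycle p"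
      unfolding acyclic_def cycle_def using reachable1_awalk by auto
  qed
qed

lemma out_degree_with_proj: "out_degree (with_proj H) v = card {a \<in> parcs H. fst a = v}"
  by (simp add: out_degree_def out_arcs_def)

lemma sinks_eq: "finite (parcs H) \<Longrightarrow> sinks H = pverts H - Domain (parcs H)"
  by (fastforce simp: sinks_def out_degree_with_proj)

lemma is_wgraph_iff:
  assumes "pair_digraph G"
  shows "is_wgraph G k H \<longleftrightarrow> pverts H = pverts G \<and> wforest G k (parcs H)"
proof -
  interpret G: pair_digraph G by fact
  have sub: "finite (parcs H) \<and> pair_wf_digraph H \<and> spanning (with_proj H) (with_proj G)"
    if "pverts H = pverts G" "parcs H \<subseteq> parcs G"
  proof -
    have "finite (parcs H)" using that G.pair_finite_arcs finite_subset by blast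
    moreover have wf: "pair_wf_digraph H"
      using that G.in_arcsD1 G.in_arcsD2 by unfold_locales auto
    moreover have "spanning (with_proj H) (with_proj G)"
      unfolding spanning_def subgraph_def compatible_def
      using that wf G.wf_digraph_axioms by (auto simp: wf_digraph_wp_iff)
    ultimately show ?thesis by blast
  qed
  show ?thesis
  proof
    assume H: "is_wgraph G k H"
    then have vs: "pverts H = pverts G" and as: "parcs H \<subseteq> parcs G"
      by (auto simp: is_wgraph_def spanning_def subgraph_def)
    note fin = sub[OF vs as]
    obtain T where T: "T \<subseteq> pverts G" "card T = k" "card (parcs H) = card (pverts G) - k"
      and deg: "\<forall>v \<in> T. out_degree (with_proj H) v = 0"
        "\<forall>v \<in> pverts G - T. out_degree (with_proj H) v = 1"
      using H by (auto simp: is_wgraph_def)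
    \<comment> \<open>Ensures that the subtraction in the arc count of \<open>is_wgraph\<close> is
      not truncated.\<close>
    have "k \<le> card (pverts G)" using T card_mono G.pair_finite_verts by blast
    moreover have "single_valued (parcs H)"
    proof (rule single_valuedI)
      fix x y z assume xy: "(x, y) \<in> parcs H" and xz: "(x, z) \<in> parcs H"
      have "x \<in> pverts G" using xy as G.in_arcsD1 by blast
      then have "card {a \<in> parcs H. fst a = x} \<le> 1"
        using deg by (cases "x \<in> T") (auto simp: out_degree_with_proj)
      then have "\<forall>a \<in> {a \<in> parcs H. fst a = x}. \<forall>b \<in> {a \<in> parcs H. fst a = x}. a = b"
        using fin card_le_Suc0_iff_eq[of "{a \<in> parcs H. fst a = x}"] by simp
      then show "y = z" using xy xz by auto
    qed
    ultimately show "pverts H = pverts G \<and> wforest G k (parcs H)"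
      using vs as T fin H acyclic_iff_no_cycle by (auto simp: wforest_def is_wgraph_def)
  next
    assume H: "pverts H = pverts G \<and> wforest G k (parcs H)"
    then have vs: "pverts H = pverts G" and as: "parcs H \<subseteq> parcs G"
      and sv: "single_valued (parcs H)" and ac: "acyclic (parcs H)"
      and card: "card (parcs H) + k = card (pverts G)"
      by (auto simp: wforest_def)
    note fin = sub[OF vs as]
    have dom: "Domain (parcs H) \<subseteq> pverts G" using as G.in_arcsD1 by blast
    have "card (pverts G - Domain (parcs H)) = card (pverts G) - card (Domain (parcs H))"
      using dom G.pair_finite_verts by (meson card_Diff_subset finite_subset)
    then have "card (pverts G - Domain (parcs H)) = k"
      using card card_single_valued[OF sv] by simp
    moreover have "out_degree (with_proj H) v = 0" if "v \<notin> Domain (parcs H)" for v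
    proof -
      have "{a \<in> parcs H. fst a = v} = {}" using that by auto
      then show ?thesis by (simp only: out_degree_with_proj card.empty)
    qed
    moreover have "out_degree (with_proj H) v = 1" if v: "v \<in> Domain (parcs H)" for v
    proof -
      obtain w where "(v, w) \<in> parcs H" using v by blast
      then have "{a \<in> parcs H. fst a = v} = {(v, w)}" using sv by (auto dest: single_valuedD)
      then show ?thesis by (simp add: out_degree_with_proj)
    qed
    ultimately show "is_wgraph G k H"
      using fin card ac acyclic_iff_no_cycle[of H] unfolding is_wgraph_def
      by (auto intro!: exI[of _ "pverts G - Domain (parcs H)"])
  qed
qed

section \<open>Connected components and their sinks, in relational terms\<close>

lemma conn_component:
  assumes "pair_wf_digraph H" "C \<in> conn_components H"
  shows "C \<subseteq> pverts H" and "C \<noteq> {}"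
    and "\<And>u v. (u, v) \<in> parcs H \<Longrightarrow> u \<in> C \<longleftrightarrow> v \<in> C"
    and "\<And>u v. u \<in> C \<Longrightarrow> v \<in> C \<Longrightarrow> (u, v) \<in> (parcs H \<union> (parcs H)\<inverse>)\<^sup>*"
proof -
  interpret H: pair_wf_digraph H by fact
  interpret S: pair_wf_digraph "mk_symmetric (with_proj H)"
    by (rule H.wellformed_mk_symmetric)
  have arcs: "parcs (mk_symmetric (with_proj H)) = parcs H \<union> (parcs H)\<inverse>"
    by (auto simp: parcs_mk_symmetric)
  have C: "C \<in> S.sccs_verts" using assms(2) by (simp add: conn_components_def)
  show "C \<subseteq> pverts H" using S.sccs_verts_subsets[OF C] by simp
  show "C \<noteq> {}" using C S.in_sccs_verts_conv_reachable by blast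
  show "(u, v) \<in> (parcs H \<union> (parcs H)\<inverse>)\<^sup>*" if "u \<in> C" "v \<in> C" for u v
  proof -
    have "u \<rightarrow>\<^sup>*\<^bsub>with_proj (mk_symmetric (with_proj H))\<^esub> v"
      using C that S.in_sccs_verts_conv_reachable by blast
    then show ?thesis
      unfolding reachable_def by (auto simp: arcs dest: rtrancl_on_rtranclI)
  qed
  show "u \<in> C \<longleftrightarrow> v \<in> C" if "(u, v) \<in> parcs H" for u v
  proof -
    have "u \<rightarrow>\<^sup>*\<^bsub>with_proj (mk_symmetric (with_proj H))\<^esub> v"
      "v \<rightarrow>\<^sup>*\<^bsub>with_proj (mk_symmetric (with_proj H))\<^esub> u"
      using that by (auto intro!: S.reachable_adjI simp: arcs)
    then show ?thesis
      using C S.in_sccs_verts_conv_reachable by blast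
  qed
qed

lemma conn_components_partition:
  assumes "pair_wf_digraph H"
  shows "v \<in> pverts H \<Longrightarrow> \<exists>C \<in> conn_components H. v \<in> C"
    and "C \<in> conn_components H \<Longrightarrow> D \<in> conn_components H \<Longrightarrow> C \<noteq> D \<Longrightarrow> C \<inter> D = {}"
proof -
  interpret H: pair_wf_digraph H by fact
  interpret S: pair_wf_digraph "mk_symmetric (with_proj H)"
    by (rule H.wellformed_mk_symmetric)
  show "\<exists>C \<in> conn_components H. v \<in> C" if "v \<in> pverts H"
    unfolding conn_components_def
    using that S.scc_of_in_sccs_verts[of v] S.in_scc_of_self[of v] by auto
  show "C \<inter> D = {}" if "C \<in> conn_components H" "D \<in> conn_components H" "C \<noteq> D"
    using that S.sccs_verts_disjoint unfolding conn_components_def by blast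
qed

text \<open>No arc leaves a component, so by \<open>finite_acyclic_exit\<close> not all its vertices
  can be tails. Of two sinks joined by an undirected path, one reaches the other along arcs, hence
  they coincide.\<close>

lemma conn_component_sink:
  assumes "pair_wf_digraph H" "finite (parcs H)" "single_valued (parcs H)" "acyclic (parcs H)"
    and C: "C \<in> conn_components H"
  obtains r where "C - Domain (parcs H) = {r}"
proof -
  note conn = conn_component[OF assms(1) C]
  have "\<not> C \<subseteq> Domain (parcs H)"
    using finite_acyclic_exit[OF assms(2,4) conn(2)] conn(3) by blast
  then obtain r where r: "r \<in> C" "r \<notin> Domain (parcs H)" by blast
  have "t = r" if "t \<in> C" "t \<notin> Domain (parcs H)" for t
  proof -
    have "(t, r) \<in> (parcs H)\<^sup>*"
      using single_valued_symcl_sink[OF assms(3) conn(4)[OF r(1) that(1)] rtrancl_refl r(2)] .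
    then show ?thesis using that by (auto elim: converse_rtranclE)
  qed
  with r show thesis using that by blast
qed

section \<open>The exchange argument\<close>

definition unique_min :: "'a pair_pre_digraph \<Rightarrow> ('a \<times> 'a) weight_fun \<Rightarrow> nat \<Rightarrow> 'a rel \<Rightarrow> bool" where
  "unique_min G U k F \<longleftrightarrow>
     wforest G k F \<and> (\<forall>H. wforest G k H \<longrightarrow> sum U H \<le> sum U F \<longrightarrow> H = F)"

text \<open>With equal total weight, one of \<open>H\<close>, \<open>H'\<close> is no heavier than
  its optimal counterpart and so equals it; the remaining two weights are then equal as
  well.\<close>

lemma unique_min_exchange:
  assumes "unique_min G U k F" "unique_min G U l F'" "wforest G k H" "wforest G l H'"
    and "sum U H + sum U H' = sum U F + sum U F'"
  shows "H = F" "H' = F'"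
proof -
  have "H = F \<or> H' = F'"
  proof (cases "sum U H \<le> sum U F")
    case False
    then have "sum U H' \<le> sum U F'" using assms(5) by linarith
    then show ?thesis using assms by (auto simp: unique_min_def)
  qed (use assms in \<open>auto simp: unique_min_def\<close>)
  then have "sum U H \<le> sum U F" "sum U H' \<le> sum U F'" using assms(5) by auto
  then show "H = F" "H' = F'" using assms by (auto simp: unique_min_def)
qed

lemma unique_min_optimal_wgraph:
  assumes G: "pair_digraph G" and ex: "\<exists>!g. is_optimal_wgraph G U k g"
  shows "pverts (optimal_wgraph G U k) = pverts G"
    and "unique_min G U k (parcs (optimal_wgraph G U k))"
proof -
  let ?g = "optimal_wgraph G U k"
  obtain h where "is_optimal_wgraph G U k h" using ex by blast
  then have opt: "is_optimal_wgraph G U k ?g"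
    unfolding optimal_wgraph_def arg_min_def by (rule someI)
  then have wg: "is_wgraph G k ?g" by (simp add: is_arg_min_def)
  then show vs: "pverts ?g = pverts G" using is_wgraph_iff[OF G] by blast
  have "H = parcs ?g" if H: "wforest G k H" "sum U H \<le> sum U (parcs ?g)" for H
  proof -
    \<comment> \<open>The competing arc set becomes a graph on all vertices; being no heavier than a
      minimizer, it is a minimizer too.\<close>
    define h where "h = \<lparr>pverts = pverts G, parcs = H\<rparr>"
    have "is_wgraph G k h" using H is_wgraph_iff[OF G] by (simp add: h_def)
    moreover have "total_weight U h \<le> total_weight U ?g"
      using H by (simp add: h_def total_weight_def)
    ultimately have "is_optimal_wgraph G U k h"
      using opt unfolding is_arg_min_linorder by (meson order_trans)
    then have "h = ?g" using ex opt by blast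
    then show ?thesis by (metis h_def pair_pre_digraph.select_convs(2))
  qed
  then show "unique_min G U k (parcs ?g)"
    using wg is_wgraph_iff[OF G] by (simp add: unique_min_def)
qed

text \<open>\<open>C\<close> stands for any component of \<open>F'\<close> free of sinks of
  \<open>F\<close>, and \<open>r\<close> for its sink in \<open>F'\<close>. That only one such
  component exists is derived later, from the agreement of \<open>F\<close> and \<open>F'\<close>
  off \<open>C\<close>.\<close>

locale absorption =
  fixes G :: "'a pair_pre_digraph" and U k F F' C r
  assumes G: "pair_digraph G"
    and F: "unique_min G U k F" and F': "unique_min G U (Suc k) F'"
    and C_closed: "\<And>u v. (u, v) \<in> F' \<Longrightarrow> u \<in> C \<longleftrightarrow> v \<in> C"
    and C_root: "C - Domain F' = {r}"
    and C_no_sink: "C \<subseteq> Domain F"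
begin

lemma forests:
  "F \<subseteq> parcs G" "single_valued F" "acyclic F" "card F + k = card (pverts G)" "finite F"
  "F' \<subseteq> parcs G" "single_valued F'" "acyclic F'" "card F' + Suc k = card (pverts G)" "finite F'"
proof -
  interpret pair_digraph G by (rule G)
  show "F \<subseteq> parcs G" "single_valued F" "acyclic F" "card F + k = card (pverts G)"
    "F' \<subseteq> parcs G" "single_valued F'" "acyclic F'" "card F' + Suc k = card (pverts G)"
    using F F' by (simp_all add: unique_min_def wforest_def)
  then show "finite F" "finite F'" using pair_finite_arcs finite_subset by blast+
qed

lemma card_eq: "card F = Suc (card F')"
  using forests by linarith

lemma wforest_splice:
  assumes "acyclic (splice X F F')" "card (Domain (splice X F F')) + l = card (pverts G)"
  shows "wforest G l (splice X F F')"
proof -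
  have sv: "single_valued (splice X F F')" using forests by (intro single_valued_splice)
  then show ?thesis
    using assms forests card_single_valued[OF sv] by (auto simp: wforest_def splice_def)
qed

lemma wforest_splice':
  assumes "acyclic (splice X F' F)" "card (Domain (splice X F' F)) + l = card (pverts G)"
  shows "wforest G l (splice X F' F)"
  using wforest_splice[of "- X" l] assms by (simp add: splice_Compl)

text \<open>Exchange on \<open>C\<close>: within \<open>C\<close> only \<open>r\<close> is a tail of
  \<open>F\<close> but not of \<open>F'\<close>, so \<open>splice C F F'\<close> has
  \<open>k\<close> sinks and \<open>splice C F' F\<close> has \<open>k + 1\<close>. Uniqueness
  identifies the former with \<open>F\<close>, and off \<open>C\<close> it consists of arcs of
  \<open>F'\<close>.\<close>

lemma agree_off: "u \<notin> C \<Longrightarrow> (u, v) \<in> F \<longleftrightarrow> (u, v) \<in> F'"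
proof -
  have "Domain (splice C F F') = insert r (Domain F')" "r \<notin> Domain F'"
    using C_root C_no_sink by (auto simp: Domain_splice)
  then have "card (Domain (splice C F F')) = Suc (card F')"
    using forests by (simp add: card_single_valued finite_Domain)
  moreover have "acyclic (splice C F F')"
    using forests C_closed by (intro acyclic_splice) auto
  ultimately have 1: "wforest G k (splice C F F')"
    using forests by (intro wforest_splice) auto
  have "Domain (splice C F' F) = Domain F - {r}" "r \<in> Domain F"
    using C_root C_no_sink by (auto simp: Domain_splice)
  then have "card (Domain (splice C F' F)) = card F'"
    using forests by (simp add: card_single_valued[symmetric] finite_Domain card_eq)
  \<comment> \<open>Seen from the complement, the closure condition says that no arc of
    \<open>F'\<close> leaves \<open>C\<close>.\<close>
  moreover have "acyclic (splice (- C) F F')"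
    using forests C_closed by (intro acyclic_splice) auto
  ultimately have "wforest G (Suc k) (splice C F' F)"
    using forests by (intro wforest_splice') (auto simp: splice_Compl)
  then have "splice C F F' = F"
    using 1 F F' unique_min_exchange(1) sum_splice forests by metis
  then show "u \<notin> C \<Longrightarrow> (u, v) \<in> F \<longleftrightarrow> (u, v) \<in> F'"
    using mem_splice[of u v C F F'] by simp
qed

lemma stays_off: "(u, v) \<in> F \<Longrightarrow> u \<notin> C \<Longrightarrow> v \<notin> C"
  using agree_off C_closed by blast

text \<open>Otherwise the part \<open>D\<close> of \<open>C\<close> that \<open>F\<close> leads to
  \<open>a\<close> misses \<open>r\<close>. An exchange on \<open>D\<close> then preserves both sink
  counts, and uniqueness puts the exit arc \<open>(a, b)\<close> into \<open>F'\<close>, which has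
  no arc leaving \<open>C\<close>.\<close>

lemma root_reaches_exit:
  assumes ab: "(a, b) \<in> F" "a \<in> C" "b \<notin> C"
  shows "(r, a) \<in> F\<^sup>*"
proof (rule ccontr)
  assume r: "(r, a) \<notin> F\<^sup>*"
  define D where "D = {v \<in> C. (v, a) \<in> F\<^sup>*}"
  have dom: "D \<subseteq> Domain F" "D \<subseteq> Domain F'"
    using C_no_sink C_root r by (auto simp: D_def)
  have stays: "v \<notin> C" if "(u, v) \<in> F\<^sup>*" "u \<notin> C" for u v
    using that by induction (auto dest: stays_off)
  have not_enter: "v \<notin> D" if "(u, v) \<in> F" "u \<notin> D" for u v
    using that stays_off by (auto simp: D_def intro: converse_rtrancl_into_rtrancl)
  have exit: "v \<in> D \<or> v \<notin> C" if "(u, v) \<in> F" "u \<in> D" for u v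
  proof (cases "u = a")
    case True
    then show ?thesis using that ab forests by (metis single_valuedD)
  next
    case False
    moreover have "(u, a) \<in> F\<^sup>*" using that by (simp add: D_def)
    ultimately obtain w where "(u, w) \<in> F" "(w, a) \<in> F\<^sup>*" by (metis converse_rtranclE)
    then show ?thesis using that forests by (auto simp: D_def dest: single_valuedD)
  qed
  \<comment> \<open>Every vertex of \<open>D\<close> is a tail in both forests, so the exchange
    moves no sink.\<close>
  have doms: "Domain (splice D F F') = Domain F'" "Domain (splice D F' F) = Domain F"
    using dom by (auto simp: Domain_splice)
  \<comment> \<open>Off \<open>C\<close> the forests agree, so the splice may be read as
    \<open>F\<close> altered on \<open>C - D\<close> only. Acyclicity then asks that no arc of
    \<open>F\<close> enters \<open>C - D\<close> from outside it: \<open>exit\<close> covers tails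
    in \<open>D\<close>, \<open>stays_off\<close> those off \<open>C\<close>.\<close>
  have "splice D F F' = splice (C - D) F' F"
    using agree_off by (auto simp: mem_splice D_def split: if_splits)
  moreover have "acyclic (splice (C - D) F' F)"
    using forests exit stays_off by (intro acyclic_splice) blast+
  ultimately have "acyclic (splice D F F')" by simp
  then have "wforest G (Suc k) (splice D F F')"
    using forests by (intro wforest_splice) (simp_all add: doms card_single_valued)
  moreover have "acyclic (splice D F' F)"
    using forests(8,3) not_enter by (rule acyclic_splice)
  then have "wforest G k (splice D F' F)"
    using forests by (intro wforest_splice') (simp_all add: doms card_single_valued)
  ultimately have "splice D F' F = F"
    using F F' unique_min_exchange(1) sum_splice forests by (metis add.commute)
  moreover have "a \<in> D" using ab by (simp add: D_def)
  ultimately have "(a, b) \<in> F'" using ab mem_splice by metis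
  then show False using C_closed ab by blast
qed

text \<open>All exit tails lie on the single \<open>F\<close>-path from \<open>r\<close>, so one of
  any two reaches the other. After its first exit the path never returns to \<open>C\<close>, so the
  tails coincide.\<close>

lemma unique_exit: "\<exists>!a. a \<in> F \<and> fst a \<in> C \<and> snd a \<notin> C"
proof -
  have eq: "c = a" if ac: "(a, c) \<in> F\<^sup>*" and "(a, b) \<in> F" "b \<notin> C" "c \<in> C" for a b c
  proof (rule ccontr)
    assume "c \<noteq> a"
    then obtain w where "(a, w) \<in> F" "(w, c) \<in> F\<^sup>*" using ac by (auto elim: converse_rtranclE)
    then have "(b, c) \<in> F\<^sup>*" using that forests by (metis single_valuedD)
    then have "c \<notin> C" using \<open>b \<notin> C\<close> by induction (auto dest: stays_off)
    then show False using that by blast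
  qed
  have uniq: "a = c \<and> b = d"
    if "(a, b) \<in> F" "a \<in> C" "b \<notin> C" "(c, d) \<in> F" "c \<in> C" "d \<notin> C" for a b c d
  proof -
    have "(r, a) \<in> F\<^sup>*" "(r, c) \<in> F\<^sup>*" using that root_reaches_exit by auto
    then have "(a, c) \<in> F\<^sup>* \<or> (c, a) \<in> F\<^sup>*"
      using forests(2) single_valued_confluent by metis
    then have "a = c" using that eq by metis
    then show ?thesis using that forests by (metis single_valuedD)
  qed
  have "C \<noteq> {}" using C_root by auto
  then obtain u v where "(u, v) \<in> F" "u \<in> C" "v \<notin> C"
    using finite_acyclic_exit[OF forests(5,3)] C_no_sink by metis
  then show ?thesis
    by (intro ex1I[of _ "(u, v)"]) (use uniq in \<open>auto simp: split_paired_all\<close>)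
qed

end

section \<open>The sinkless component of the optimal W-graphs\<close>

theorem theorem1:
  fixes G :: "'a pair_pre_digraph" and U :: "('a \<times> 'a) weight_fun"
  assumes "pair_digraph G"
    and unique: "\<And>k. 1 \<le> k \<Longrightarrow> k \<le> card (pverts G) \<Longrightarrow> \<exists>!g. is_optimal_wgraph G U k g"
  shows "\<forall>k. 1 \<le> k \<and> k < card (pverts G) \<longrightarrow>
    (let g = optimal_wgraph G U k;
         g' = optimal_wgraph G U (k + 1);
         S\<^sub>k = absorbed_component G U k
     in sinks g \<subseteq> sinks g' \<and>
        (\<exists>!C. is_sinkless_component G U k C) \<and>
        {a \<in> parcs g'. fst a \<in> pverts G - S\<^sub>k} = {a \<in> parcs g. fst a \<in> pverts G - S\<^sub>k} \<and>
        (\<exists>!a. a \<in> parcs g \<and> fst a \<in> S\<^sub>k \<and> snd a \<in> pverts G - S\<^sub>k))"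
proof (intro allI impI)
  fix k assume k: "1 \<le> k \<and> k < card (pverts G)"
  interpret pair_digraph G by fact
  define g where "g = optimal_wgraph G U k"
  define g' where "g' = optimal_wgraph G U (k + 1)"
  have g: "pverts g = pverts G" "unique_min G U k (parcs g)"
    using unique_min_optimal_wgraph[OF assms(1) unique[of k]] k by (auto simp: g_def)
  have g': "pverts g' = pverts G" "unique_min G U (Suc k) (parcs g')"
    using unique_min_optimal_wgraph[OF assms(1) unique[of "k + 1"]] k by (auto simp: g'_def)
  have forest: "parcs g \<subseteq> parcs G" "parcs g' \<subseteq> parcs G"
    "single_valued (parcs g)" "single_valued (parcs g')" "acyclic (parcs g')"
    "card (parcs g) + k = card (pverts G)" "card (parcs g') + Suc k = card (pverts G)"
    using g g' by (auto simp: unique_min_def wforest_def)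
  have fin: "finite (parcs g)" "finite (parcs g')"
    using forest pair_finite_arcs finite_subset by blast+
  have sinks: "sinks g = pverts G - Domain (parcs g)" "sinks g' = pverts G - Domain (parcs g')"
    using g g' fin by (simp_all add: sinks_eq)
  have dom: "Domain (parcs g) \<subseteq> pverts G" "Domain (parcs g') \<subseteq> pverts G"
    using forest in_arcsD1 by blast+
  have card_sinks: "card (sinks g) = k" "card (sinks g') = Suc k"
    using forest dom pair_finite_verts unfolding sinks
    by (auto simp: card_Diff_subset finite_subset card_single_valued[symmetric])
  have wf: "pair_wf_digraph g'"
    using g' forest(2) in_arcsD1 in_arcsD2 by unfold_locales auto
  note part = conn_components_partition[OF wf]
  have comp: "C \<subseteq> pverts G" if "C \<in> conn_components g'" for C
    using conn_component(1)[OF wf that] g' by simp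
  have absorb: "\<exists>r. absorption G U k (parcs g) (parcs g') C r"
    if "is_sinkless_component G U k C" for C
  proof -
    have C: "C \<in> conn_components g'" "C \<inter> sinks g = {}"
      using that by (auto simp: is_sinkless_component_def g_def g'_def)
    then have "C \<subseteq> Domain (parcs g)" using comp sinks by blast
    moreover obtain r where "C - Domain (parcs g') = {r}"
      using conn_component_sink[OF wf fin(2) forest(4,5) C(1)] .
    ultimately have "absorption G U k (parcs g) (parcs g') C r"
      using assms(1) g g' conn_component(3)[OF wf C(1)] by unfold_locales
    then show ?thesis ..
  qed
  \<comment> \<open>Pigeonhole: otherwise each of the \<open>k + 1\<close> sinks of
    \<open>g'\<close> is sent to a sink of \<open>g\<close> in its own component. Components are
    disjoint and hold one sink of \<open>g'\<close> each, so the map is injective into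
    \<open>k\<close> sinks.\<close>
  have "\<exists>C. is_sinkless_component G U k C"
  proof (rule ccontr)
    assume none: "\<nexists>C. is_sinkless_component G U k C"
    have "\<exists>t \<in> sinks g. \<exists>C \<in> conn_components g'. s \<in> C \<and> t \<in> C" if "s \<in> sinks g'" for s
    proof -
      have "s \<in> pverts g'" using that sinks g' by simp
      then obtain C where C: "C \<in> conn_components g'" "s \<in> C" using part(1) by blast
      moreover have "\<not> is_sinkless_component G U k C" using none by blast
      ultimately have "C \<inter> sinks g \<noteq> {}"
        by (simp add: is_sinkless_component_def g_def g'_def)
      then show ?thesis using C by blast
    qed
    then obtain f where f: "\<And>s. s \<in> sinks g' \<Longrightarrow>
        f s \<in> sinks g \<and> (\<exists>C \<in> conn_components g'. s \<in> C \<and> f s \<in> C)"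
      by metis
    have "inj_on f (sinks g')"
    proof (rule inj_onI)
      fix s t assume st: "s \<in> sinks g'" "t \<in> sinks g'" "f s = f t"
      then obtain C D where CD: "C \<in> conn_components g'" "s \<in> C" "f s \<in> C"
          "D \<in> conn_components g'" "t \<in> D" "f s \<in> D"
        using f by metis
      then have "C = D" using part(2) by blast
      moreover obtain r where "C - Domain (parcs g') = {r}"
        using conn_component_sink[OF wf fin(2) forest(4,5) CD(1)] .
      moreover have "s \<notin> Domain (parcs g')" "t \<notin> Domain (parcs g')"
        using st(1,2) unfolding sinks(2) by blast+
      ultimately show "s = t" using CD(2,5) by (metis DiffI singletonD)
    qed
    moreover have "f ` sinks g' \<subseteq> sinks g" using f by blast
    moreover have "finite (sinks g)" using sinks pair_finite_verts by simp
    ultimately have "card (sinks g') \<le> card (sinks g)" by (rule card_inj_on_le)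
    then show False using card_sinks by simp
  qed
  then obtain C where C: "is_sinkless_component G U k C" by blast
  obtain r where "absorption G U k (parcs g) (parcs g') C r" using absorb[OF C] by blast
  then interpret absorption G U k "parcs g" "parcs g'" C r .
  have C': "C \<in> conn_components g'" "C \<inter> sinks g = {}"
    using C by (auto simp: is_sinkless_component_def g_def g'_def)
  \<comment> \<open>Sinks of \<open>g\<close> lie off \<open>C\<close>, where both graphs have the
    same outgoing arcs.\<close>
  have sub: "sinks g \<subseteq> sinks g'"
    using C' sinks agree_off by blast
  \<comment> \<open>The \<open>g'\<close>-sink of another such component lies off \<open>C\<close>,
    so by \<open>agree_off\<close> it has no arc in \<open>g\<close> and is a sink of
    \<open>g\<close>, which \<open>D\<close> must not contain.\<close>
  have uniq: "D = C" if D: "is_sinkless_component G U k D" for D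
  proof (rule ccontr)
    assume "D \<noteq> C"
    have D': "D \<in> conn_components g'" "D \<inter> sinks g = {}"
      using D by (auto simp: is_sinkless_component_def g_def g'_def)
    then have "D \<inter> C = {}" using part(2) C' \<open>D \<noteq> C\<close> by blast
    moreover obtain t where "D - Domain (parcs g') = {t}"
      using conn_component_sink[OF wf fin(2) forest(4,5) D'(1)] .
    ultimately have "t \<in> D" "t \<notin> Domain (parcs g)" using agree_off by blast+
    then show False using D' comp sinks by blast
  qed
  have Sk: "absorbed_component G U k = C"
    unfolding absorbed_component_def using C uniq by (rule the_equality)
  have "{a \<in> parcs g'. fst a \<in> pverts G - C} = {a \<in> parcs g. fst a \<in> pverts G - C}"
    using agree_off by auto
  moreover have "\<exists>!a. a \<in> parcs g \<and> fst a \<in> C \<and> snd a \<in> pverts G - C"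
  proof -
    have "a \<in> parcs g \<and> fst a \<in> C \<and> snd a \<in> pverts G - C \<longleftrightarrow>
        a \<in> parcs g \<and> fst a \<in> C \<and> snd a \<notin> C" for a
      using forest arc_snd_in_verts by blast
    then show ?thesis using unique_exit by simp
  qed
  moreover have "\<exists>!C. is_sinkless_component G U k C" using C uniq by (rule ex1I)
  ultimately show "let g = optimal_wgraph G U k;
         g' = optimal_wgraph G U (k + 1);
         S\<^sub>k = absorbed_component G U k
     in sinks g \<subseteq> sinks g' \<and>
        (\<exists>!C. is_sinkless_component G U k C) \<and>
        {a \<in> parcs g'. fst a \<in> pverts G - S\<^sub>k} = {a \<in> parcs g. fst a \<in> pverts G - S\<^sub>k} \<and>
        (\<exists>!a. a \<in> parcs g \<and> fst a \<in> S\<^sub>k \<and> snd a \<in> pverts G - S\<^sub>k)"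
    unfolding Let_def Sk g_def[symmetric] g'_def[symmetric] using sub by (intro conjI)
qed

end
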